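(* The following decision problem subsumes the analytical hierarchy, i.e. every set $X\subseteq\mathbb N$ belonging to $\Sigma^1_n$ or $\Pi^1_n$ for some $n$ is many-one reducible to it: given an equational bitstream specification $E$ over a bitstream signature $\Sigma$ and terms $s,t$ of sort $S$, decide whether $s$ and $t$ are equal in all full models of $E$, i.e. whether every full stream model $\mathcal A$ of $E$ satisfies $[\![s]\!]^{\mathcal A}_\alpha=[\![t]\!]^{\mathcal A}_\alpha$ for all variable assignments $\alpha$.
   Context: Sorts are $B$ (bits) and $S$ (bitstreams). A bitstream signature $\Sigma$ is a set of function symbols, each with a type $f :: s_1\times\cdots\times s_n\to s$ with $s_i,s\in\{B,S\}$, containing $0,1::B$ and the infix stream constructor $:\,::B\times S\to S$. An equational bitstream specification over $\Sigma$ is a finite set of equations between sorted terms of the same sort (terms may contain sorted variables). A stream algebra $\mathcal{A}=\langle A,[\![\cdot]\!]\rangle$ consists of $A_B=\{0,1\}$, a nonempty $A_S\subseteq\{0,1\}^{\mathbb N}$, and functions $[\![f]\!]:A_{s_1}\times\cdots\times A_{s_n}\to A_s$ for each symbol, with $[\![:]\!](x,\sigma)=x:\sigma$, $[\![0]\!]=0$, $[\![1]\!]=1$. $\mathcal A$ is a model of $E$ if both sides of every equation of $E$ have equal interpretations under every sort-respecting variable assignment into $A$. $\mathcal A$ is full if $A_S=\{0,1\}^{\mathbb N}$. Instances are coded as natural numbers; many-one reductions are by partial recursive functions. *)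

theory Defs
  imports Main "HOL-Library.Nat_Bijection"
begin

section \<open>Bitstream signatures, terms and specifications\<close>

datatype bsort = BitSort | StreamSort

datatype fsym = Bit0 | Bit1 | SCons | Sym nat

type_synonym ftype = "bsort list \<times> bsort"

text \<open>The domain of a signature is its set of function symbols.\<close>

type_synonym signature = "fsym \<Rightarrow> ftype option"

definition bitstream_signature :: "signature \<Rightarrow> bool" where
  "bitstream_signature \<Sigma> \<longleftrightarrow>
     \<Sigma> Bit0 = Some ([], BitSort) \<and>
     \<Sigma> Bit1 = Some ([], BitSort) \<and>
     \<Sigma> SCons = Some ([BitSort, StreamSort], StreamSort)"

datatype bterm = Var bsort nat | App fsym "bterm list"

inductive has_sort :: "signature \<Rightarrow> bterm \<Rightarrow> bsort \<Rightarrow> bool" for \<Sigma> where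
  "has_sort \<Sigma> (Var s x) s"
| "\<Sigma> f = Some (ss, s) \<Longrightarrow> list_all2 (has_sort \<Sigma>) ts ss \<Longrightarrow> has_sort \<Sigma> (App f ts) s"

type_synonym equation = "bterm \<times> bterm"

definition bitstream_spec :: "signature \<Rightarrow> equation set \<Rightarrow> bool" where
  "bitstream_spec \<Sigma> E \<longleftrightarrow>
     bitstream_signature \<Sigma> \<and> finite E \<and>
     (\<forall>(l, r) \<in> E. \<exists>s. has_sort \<Sigma> l s \<and> has_sort \<Sigma> r s)"


section \<open>Stream algebras and models\<close>

text \<open>The bits 0 and 1 are \<open>False\<close> and \<open>True\<close>; bitstreams are functions from \<open>nat\<close> to bits.\<close>

datatype val = BitVal bool | StreamVal "nat \<Rightarrow> bool"

type_synonym interp = "fsym \<Rightarrow> val list \<Rightarrow> val"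

fun carrier :: "(nat \<Rightarrow> bool) set \<Rightarrow> bsort \<Rightarrow> val set" where
  "carrier A BitSort = range BitVal"
| "carrier A StreamSort = StreamVal ` A"

definition stream_algebra :: "signature \<Rightarrow> (nat \<Rightarrow> bool) set \<Rightarrow> interp \<Rightarrow> bool" where
  "stream_algebra \<Sigma> A I \<longleftrightarrow>
     A \<noteq> {} \<and>
     (\<forall>f ss s vs. \<Sigma> f = Some (ss, s) \<longrightarrow> list_all2 (\<lambda>v u. v \<in> carrier A u) vs ss \<longrightarrow>
        I f vs \<in> carrier A s) \<and>
     I Bit0 [] = BitVal False \<and>
     I Bit1 [] = BitVal True \<and>
     (\<forall>b. \<forall>\<sigma>\<in>A. I SCons [BitVal b, StreamVal \<sigma>] = StreamVal (case_nat b \<sigma>))"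

type_synonym assignment = "bsort \<Rightarrow> nat \<Rightarrow> val"

definition sort_respecting :: "(nat \<Rightarrow> bool) set \<Rightarrow> assignment \<Rightarrow> bool" where
  "sort_respecting A \<alpha> \<longleftrightarrow> (\<forall>s x. \<alpha> s x \<in> carrier A s)"

fun eval_term :: "interp \<Rightarrow> assignment \<Rightarrow> bterm \<Rightarrow> val" where
  "eval_term I \<alpha> (Var s x) = \<alpha> s x"
| "eval_term I \<alpha> (App f ts) = I f (map (eval_term I \<alpha>) ts)"

definition satisfies_eq :: "(nat \<Rightarrow> bool) set \<Rightarrow> interp \<Rightarrow> equation \<Rightarrow> bool" where
  "satisfies_eq A I e \<longleftrightarrow>
     (\<forall>\<alpha>. sort_respecting A \<alpha> \<longrightarrow> eval_term I \<alpha> (fst e) = eval_term I \<alpha> (snd e))"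

definition is_model :: "signature \<Rightarrow> equation set \<Rightarrow> (nat \<Rightarrow> bool) set \<Rightarrow> interp \<Rightarrow> bool" where
  "is_model \<Sigma> E A I \<longleftrightarrow> stream_algebra \<Sigma> A I \<and> (\<forall>e\<in>E. satisfies_eq A I e)"

definition full_model :: "signature \<Rightarrow> equation set \<Rightarrow> (nat \<Rightarrow> bool) set \<Rightarrow> interp \<Rightarrow> bool" where
  "full_model \<Sigma> E A I \<longleftrightarrow> is_model \<Sigma> E A I \<and> A = UNIV"

definition equal_in_all_full_models :: "signature \<Rightarrow> equation set \<Rightarrow> bterm \<Rightarrow> bterm \<Rightarrow> bool" where
  "equal_in_all_full_models \<Sigma> E s t \<longleftrightarrow>
     (\<forall>A I. full_model \<Sigma> E A I \<longrightarrow> satisfies_eq A I (s, t))"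


section \<open>Instances and their codes\<close>

text \<open>
  To be a finite object, an instance presents its signature by the list of the types of
  \<open>Sym 0\<close>, \<open>Sym 1\<close>, \dots, and its specification by a list of equations.
\<close>

fun sig_of :: "ftype list \<Rightarrow> signature" where
  "sig_of ds Bit0 = Some ([], BitSort)"
| "sig_of ds Bit1 = Some ([], BitSort)"
| "sig_of ds SCons = Some ([BitSort, StreamSort], StreamSort)"
| "sig_of ds (Sym i) = (if i < length ds then Some (ds ! i) else None)"

fun sort_code :: "bsort \<Rightarrow> nat" where
  "sort_code BitSort = 0"
| "sort_code StreamSort = 1"

fun fsym_code :: "fsym \<Rightarrow> nat" where
  "fsym_code Bit0 = 0"
| "fsym_code Bit1 = 1"
| "fsym_code SCons = 2"
| "fsym_code (Sym i) = i + 3"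

fun ftype_code :: "ftype \<Rightarrow> nat" where
  "ftype_code (ss, s) = prod_encode (list_encode (map sort_code ss), sort_code s)"

fun term_code :: "bterm \<Rightarrow> nat" where
  "term_code (Var s x) = sum_encode (Inl (prod_encode (sort_code s, x)))"
| "term_code (App f ts) =
     sum_encode (Inr (prod_encode (fsym_code f, list_encode (map term_code ts))))"

fun equation_code :: "equation \<Rightarrow> nat" where
  "equation_code (l, r) = prod_encode (term_code l, term_code r)"

type_synonym problem_instance = "ftype list \<times> equation list \<times> bterm \<times> bterm"

fun instance_code :: "problem_instance \<Rightarrow> nat" where
  "instance_code (ds, es, s, t) =
     prod_encode (list_encode (map ftype_code ds),
       prod_encode (list_encode (map equation_code es),
         prod_encode (term_code s, term_code t)))"

lemmas encode_eqs = prod_encode_eq sum_encode_eq list_encode_eq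

lemma inj_sort_code: "inj sort_code"
proof (rule injI)
  fix x y show "sort_code x = sort_code y \<Longrightarrow> x = y"
    by (cases x; cases y) auto
qed

lemma inj_fsym_code: "inj fsym_code"
proof (rule injI)
  fix x y show "fsym_code x = fsym_code y \<Longrightarrow> x = y"
    by (cases x; cases y) auto
qed

lemma inj_ftype_code: "inj ftype_code"
proof (rule injI)
  fix x y show "ftype_code x = ftype_code y \<Longrightarrow> x = y"
    by (cases x; cases y) (auto simp: encode_eqs inj_eq[OF inj_sort_code] inj_map_eq_map[OF inj_sort_code])
qed

lemma term_code_eqD: "term_code t = term_code u \<Longrightarrow> t = u"
proof (induction t arbitrary: u)
  case (Var s x)
  then show ?case by (cases u) (auto simp: encode_eqs inj_eq[OF inj_sort_code])
next
  case (App f ts)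
  then obtain us where u: "u = App f us" and eq: "map term_code ts = map term_code us"
    by (cases u) (auto simp: encode_eqs inj_eq[OF inj_fsym_code])
  have "ts = us"
    using eq App.IH
  proof (induction ts arbitrary: us)
    case (Cons t ts)
    then show ?case by (cases us) auto
  qed simp
  with u show ?case by simp
qed

lemma inj_term_code: "inj term_code"
  by (rule injI) (rule term_code_eqD)

lemma inj_equation_code: "inj equation_code"
proof (rule injI)
  fix x y show "equation_code x = equation_code y \<Longrightarrow> x = y"
    by (cases x; cases y) (auto simp: encode_eqs dest: term_code_eqD)
qed

lemma inj_instance_code: "inj instance_code"
proof (rule injI)
  fix x y show "instance_code x = instance_code y \<Longrightarrow> x = y"
    by (cases x; cases y)
      (auto dest: term_code_eqD
        simp: encode_eqs inj_map_eq_map[OF inj_ftype_code] inj_map_eq_map[OF inj_equation_code])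
qed

text \<open>Numbers that are not codes of well-formed instances are not members.\<close>

definition full_model_equality_problem :: "nat set" where
  "full_model_equality_problem =
     {instance_code (ds, es, s, t) | ds es s t.
        bitstream_spec (sig_of ds) (set es) \<and>
        has_sort (sig_of ds) s StreamSort \<and> has_sort (sig_of ds) t StreamSort \<and>
        equal_in_all_full_models (sig_of ds) (set es) s t}"


section \<open>Partial recursive functions and many-one reducibility\<close>

datatype recf =
    Zero_r
  | Succ_r
  | Proj_r nat
  | Comp_r recf "recf list"
  | Prim_r recf recf
  | Mu_r recf

inductive computes :: "recf \<Rightarrow> nat list \<Rightarrow> nat \<Rightarrow> bool" where
  "computes Zero_r xs 0"
| "computes Succ_r [x] (Suc x)"
| "i < length xs \<Longrightarrow> computes (Proj_r i) xs (xs ! i)"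
| "list_all2 (\<lambda>g y. computes g xs y) gs ys \<Longrightarrow> computes f ys z \<Longrightarrow> computes (Comp_r f gs) xs z"
| "computes f xs z \<Longrightarrow> computes (Prim_r f g) (0 # xs) z"
| "computes (Prim_r f g) (n # xs) y \<Longrightarrow> computes g (n # y # xs) z \<Longrightarrow>
     computes (Prim_r f g) (Suc n # xs) z"
| "computes f (n # xs) 0 \<Longrightarrow> (\<forall>m<n. \<exists>y. computes f (m # xs) (Suc y)) \<Longrightarrow> computes (Mu_r f) xs n"

definition partial_recursive :: "(nat \<Rightarrow> nat option) \<Rightarrow> bool" where
  "partial_recursive f \<longleftrightarrow> (\<exists>p. \<forall>x y. f x = Some y \<longleftrightarrow> computes p [x] y)"

text \<open>The reduction is a \<^emph>\<open>total\<close> function that is partial recursive.\<close>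

definition many_one_reducible :: "nat set \<Rightarrow> nat set \<Rightarrow> bool" where
  "many_one_reducible X Y \<longleftrightarrow>
     (\<exists>f :: nat \<Rightarrow> nat. partial_recursive (\<lambda>x. Some (f x)) \<and> (\<forall>x. x \<in> X \<longleftrightarrow> f x \<in> Y))"


section \<open>Second-order arithmetic and the analytical hierarchy\<close>

datatype nterm =
    NVar nat
  | NZero
  | NOne
  | NAdd nterm nterm
  | NMul nterm nterm

datatype form =
    Eq nterm nterm
  | Less nterm nterm
  | Mem nterm nat
  | Neg form
  | Conj form form
  | Disj form form
  | ExNum nat form
  | AllNum nat form
  | ExSet nat form
  | AllSet nat form

fun nval :: "(nat \<Rightarrow> nat) \<Rightarrow> nterm \<Rightarrow> nat" where
  "nval e (NVar i) = e i"
| "nval e NZero = 0"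
| "nval e NOne = 1"
| "nval e (NAdd a b) = nval e a + nval e b"
| "nval e (NMul a b) = nval e a * nval e b"

fun holds :: "(nat \<Rightarrow> nat) \<Rightarrow> (nat \<Rightarrow> nat set) \<Rightarrow> form \<Rightarrow> bool" where
  "holds e V (Eq a b) \<longleftrightarrow> nval e a = nval e b"
| "holds e V (Less a b) \<longleftrightarrow> nval e a < nval e b"
| "holds e V (Mem a i) \<longleftrightarrow> nval e a \<in> V i"
| "holds e V (Neg \<phi>) \<longleftrightarrow> \<not> holds e V \<phi>"
| "holds e V (Conj \<phi> \<psi>) \<longleftrightarrow> holds e V \<phi> \<and> holds e V \<psi>"
| "holds e V (Disj \<phi> \<psi>) \<longleftrightarrow> holds e V \<phi> \<or> holds e V \<psi>"
| "holds e V (ExNum i \<phi>) \<longleftrightarrow> (\<exists>k. holds (e(i := k)) V \<phi>)"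
| "holds e V (AllNum i \<phi>) \<longleftrightarrow> (\<forall>k. holds (e(i := k)) V \<phi>)"
| "holds e V (ExSet i \<phi>) \<longleftrightarrow> (\<exists>M. holds e (V(i := M)) \<phi>)"
| "holds e V (AllSet i \<phi>) \<longleftrightarrow> (\<forall>M. holds e (V(i := M)) \<phi>)"

fun arithmetical :: "form \<Rightarrow> bool" where
  "arithmetical (Neg \<phi>) = arithmetical \<phi>"
| "arithmetical (Conj \<phi> \<psi>) = (arithmetical \<phi> \<and> arithmetical \<psi>)"
| "arithmetical (Disj \<phi> \<psi>) = (arithmetical \<phi> \<and> arithmetical \<psi>)"
| "arithmetical (ExNum i \<phi>) = arithmetical \<phi>"
| "arithmetical (AllNum i \<phi>) = arithmetical \<phi>"
| "arithmetical (ExSet i \<phi>) = False"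
| "arithmetical (AllSet i \<phi>) = False"
| "arithmetical _ = True"

fun sigma_form :: "nat \<Rightarrow> form \<Rightarrow> bool" and pi_form :: "nat \<Rightarrow> form \<Rightarrow> bool" where
  "sigma_form 0 \<phi> = arithmetical \<phi>"
| "sigma_form (Suc n) \<phi> = (\<exists>is \<psi>. \<phi> = foldr ExSet is \<psi> \<and> pi_form n \<psi>)"
| "pi_form 0 \<phi> = arithmetical \<phi>"
| "pi_form (Suc n) \<phi> = (\<exists>is \<psi>. \<phi> = foldr AllSet is \<psi> \<and> sigma_form n \<psi>)"

text \<open>
  Variable number 0 is the argument. Quantifying over all assignments \<open>e\<close> and \<open>V\<close> makes the
  values of all other variables irrelevant, so that no number or set parameters are admitted
  (the lightface hierarchy).
\<close>

definition defines_set :: "form \<Rightarrow> nat set \<Rightarrow> bool" where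
  "defines_set \<phi> X \<longleftrightarrow> (\<forall>e V. e 0 \<in> X \<longleftrightarrow> holds e V \<phi>)"

definition Sigma1 :: "nat \<Rightarrow> nat set set" where
  "Sigma1 n = {X. \<exists>\<phi>. sigma_form n \<phi> \<and> defines_set \<phi> X}"

definition Pi1 :: "nat \<Rightarrow> nat set set" where
  "Pi1 n = {X. \<exists>\<phi>. pi_form n \<phi> \<and> defines_set \<phi> X}"

end

theory Submission
  imports Defs "HOL-Library.Countable"
begin

text \<open>
  Over a full model a function symbol on streams can serve as a Skolem function of a set quantifier:
  the equations \<open>e(x) = \<phi>(x, f(x))\<close> and \<open>\<phi>(x, y) \<longrightarrow> e(x) = 1\<close>, read for all streams \<open>y\<close>, force
  \<open>e(x)\<close> to be the truth value of \<open>\<exists>y. \<phi>(x, y)\<close>. Numbers are the streams starting with \<open>1\<^sup>k 0\<close>, on which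
  order, addition, multiplication and membership are determined by recursion equations. Hence for a
  fixed formula there is one specification, with two new symbols per subformula, in whose full
  models the symbol of every subformula denotes its truth; only the numeral of the argument in the
  queried term varies with the input of the reduction.
\<close>

section \<open>Second-order arithmetic over streams\<close>

text \<open>Unary coding with a free tail after the first 0: the stream constructor acts as
  successor, and only the stream of ones is left without a number.\<close>

definition codes :: "(nat \<Rightarrow> bool) \<Rightarrow> nat \<Rightarrow> bool" where
  "codes x k \<longleftrightarrow> (\<forall>i<k. x i) \<and> \<not> x k"

definition num :: "(nat \<Rightarrow> bool) \<Rightarrow> nat" where
  "num x = (if \<exists>k. codes x k then THE k. codes x k else 0)"

lemma codes_unique: "codes x k \<Longrightarrow> codes x l \<Longrightarrow> k = l"
  unfolding codes_def by (metis linorder_neqE_nat)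

lemma num_codes: "codes x k \<Longrightarrow> num x = k"
  unfolding num_def using codes_unique by (metis the_equality)

lemma codes_num: "codes x k \<Longrightarrow> codes x (num x)"
  by (simp add: num_codes)

lemma codes_False: "codes (case_nat False x) k \<longleftrightarrow> k = 0"
  by (auto simp: codes_def split: nat.splits)

lemma codes_True: "codes (case_nat True x) k \<longleftrightarrow> (\<exists>l. k = Suc l \<and> codes x l)"
  by (cases k) (auto simp: codes_def less_Suc_eq_0_disj)

lemma codes_less: "codes (\<lambda>i. i < k) k"
  by (simp add: codes_def)

lemma num_less: "num (\<lambda>i. i < k) = k"
  using codes_less by (rule num_codes)

lemma not_codes_ones: "\<not> codes (\<lambda>_. True) k"
  by (simp add: codes_def)

lemma stream_shape: "case_nat (x 0) (\<lambda>i. x (Suc i)) = (x :: nat \<Rightarrow> bool)"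
  by (auto split: nat.splits)

text \<open>Brings a code into the shape of the left-hand sides of the recursion equations, ready
  for induction on the coded number.\<close>

lemma codes_0E:
  assumes "codes x 0"
  obtains y where "x = case_nat False y"
proof
  show "x = case_nat False (\<lambda>i. x (Suc i))"
    using assms stream_shape[of x] by (simp add: codes_def)
qed

lemma codes_SucE:
  assumes "codes x (Suc k)"
  obtains y where "x = case_nat True y" "codes y k"
proof
  have "x 0" using assms by (simp add: codes_def)
  then show x: "x = case_nat True (\<lambda>i. x (Suc i))"
    using stream_shape[of x] by simp
  show "codes (\<lambda>i. x (Suc i)) k"
    using assms by (auto simp: codes_def)
qed

section \<open>A reduced formula language with one kind of quantifier\<close>

datatype core = Lt nterm nterm | In nterm nat | Nand core core | Ex nat core

abbreviation Not_c :: "core \<Rightarrow> core" where "Not_c p \<equiv> Nand p p"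
abbreviation And_c :: "core \<Rightarrow> core \<Rightarrow> core" where "And_c p q \<equiv> Not_c (Nand p q)"

text \<open>Countability supplies \<open>to_nat\<close>, by which every formula receives its own
  pair of function symbols.\<close>

instance nterm :: countable by countable_datatype
instance core :: countable by countable_datatype

text \<open>
  A single family of stream variables serves both sorts: number variable \<open>i\<close> is the number coded
  by stream variable \<open>2 * i\<close>, set variable \<open>i\<close> is stream variable \<open>2 * i + 1\<close>. As \<^const>\<open>num\<close> is total
  and surjective, no quantifier has to be relativised.
\<close>

type_synonym env = "nat \<Rightarrow> nat \<Rightarrow> bool"

abbreviation nenv :: "env \<Rightarrow> nat \<Rightarrow> nat" where
  "nenv w \<equiv> \<lambda>i. num (w (2 * i))"

abbreviation senv :: "env \<Rightarrow> nat \<Rightarrow> nat set" where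
  "senv w \<equiv> \<lambda>i. {k. w (2 * i + 1) k}"

fun sat :: "env \<Rightarrow> core \<Rightarrow> bool" where
  "sat w (Lt a b) \<longleftrightarrow> nval (nenv w) a < nval (nenv w) b"
| "sat w (In a j) \<longleftrightarrow> w j (nval (nenv w) a)"
| "sat w (Nand p q) \<longleftrightarrow> \<not> (sat w p \<and> sat w q)"
| "sat w (Ex j p) \<longleftrightarrow> (\<exists>x. sat (w(j := x)) p)"

fun core_of :: "form \<Rightarrow> core" where
  "core_of (Eq a b) = And_c (Not_c (Lt a b)) (Not_c (Lt b a))"
| "core_of (Less a b) = Lt a b"
| "core_of (Mem a i) = In a (2 * i + 1)"
| "core_of (Neg \<phi>) = Not_c (core_of \<phi>)"
| "core_of (Conj \<phi> \<psi>) = And_c (core_of \<phi>) (core_of \<psi>)"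
| "core_of (Disj \<phi> \<psi>) = Nand (Not_c (core_of \<phi>)) (Not_c (core_of \<psi>))"
| "core_of (ExNum i \<phi>) = Ex (2 * i) (core_of \<phi>)"
| "core_of (AllNum i \<phi>) = Not_c (Ex (2 * i) (Not_c (core_of \<phi>)))"
| "core_of (ExSet i \<phi>) = Ex (2 * i + 1) (core_of \<phi>)"
| "core_of (AllSet i \<phi>) = Not_c (Ex (2 * i + 1) (Not_c (core_of \<phi>)))"

lemma nenv_upd_even: "nenv (w(2 * i := x)) = (nenv w)(i := num x)"
  by auto

lemma nenv_upd_odd: "nenv (w(2 * i + 1 := x)) = nenv w"
proof
  have "2 * k \<noteq> 2 * i + 1" for k by presburger
  then show "nenv (w(2 * i + 1 := x)) k = nenv w k" for k by simp
qed

lemma senv_upd_even: "senv (w(2 * i := x)) = senv w"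
proof
  have "2 * k + 1 \<noteq> 2 * i" for k by presburger
  then show "senv (w(2 * i := x)) k = senv w k" for k by simp
qed

lemma senv_upd_odd: "senv (w(2 * i + 1 := x)) = (senv w)(i := {k. x k})"
  by (rule ext) simp

lemma ex_num: "(\<exists>x. P (num x)) \<longleftrightarrow> (\<exists>k. P k)"
  by (metis num_less)

lemma ex_stream: "(\<exists>x. P {k. x k}) \<longleftrightarrow> (\<exists>M. P M)"
  by (metis Collect_mem_eq)

text \<open>Updating an even stream variable changes only the number environment, an odd one only
  the set environment, so each stream quantifier acts as exactly one of the original
  quantifiers.\<close>

lemma sat_core_of: "sat w (core_of \<phi>) \<longleftrightarrow> holds (nenv w) (senv w) \<phi>"
proof (induction \<phi> arbitrary: w)
  case (ExNum i \<phi>)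
  show ?case
    by (simp only: core_of.simps sat.simps holds.simps ExNum nenv_upd_even senv_upd_even
        ex_num[of "\<lambda>k. holds ((nenv w)(i := k)) (senv w) \<phi>"])
next
  case (AllNum i \<phi>)
  show ?case
    by (simp only: core_of.simps sat.simps holds.simps AllNum nenv_upd_even senv_upd_even
        ex_num[of "\<lambda>k. \<not> holds ((nenv w)(i := k)) (senv w) \<phi>"] conj_absorb not_all not_not
        not_ex)
next
  case (ExSet i \<phi>)
  show ?case
    by (simp only: core_of.simps sat.simps holds.simps ExSet nenv_upd_odd senv_upd_odd
        ex_stream[of "\<lambda>M. holds (nenv w) ((senv w)(i := M)) \<phi>"])
next
  case (AllSet i \<phi>)
  show ?case
    by (simp only: core_of.simps sat.simps holds.simps AllSet nenv_upd_odd senv_upd_odd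
        ex_stream[of "\<lambda>M. \<not> holds (nenv w) ((senv w)(i := M)) \<phi>"] conj_absorb not_all not_not
        not_ex)
qed auto

section \<open>Bounding the variables of a formula\<close>

fun nvars_below :: "nat \<Rightarrow> nterm \<Rightarrow> bool" where
  "nvars_below M (NVar i) \<longleftrightarrow> 2 * i < M"
| "nvars_below M (NAdd a b) \<longleftrightarrow> nvars_below M a \<and> nvars_below M b"
| "nvars_below M (NMul a b) \<longleftrightarrow> nvars_below M a \<and> nvars_below M b"
| "nvars_below M _ \<longleftrightarrow> True"

text \<open>Bound occurrences count as well, so that a single argument list \<open>vars M\<close>
  serves all subformulas. A quantified index \<open>j\<close> may exceed the bound, but then it
  occurs in no atom of the body.\<close>

fun vars_below :: "nat \<Rightarrow> core \<Rightarrow> bool" where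
  "vars_below M (Lt a b) \<longleftrightarrow> nvars_below M a \<and> nvars_below M b"
| "vars_below M (In a j) \<longleftrightarrow> nvars_below M a \<and> j < M"
| "vars_below M (Nand p q) \<longleftrightarrow> vars_below M p \<and> vars_below M q"
| "vars_below M (Ex j p) \<longleftrightarrow> vars_below M p"

lemma nvars_below_mono: "nvars_below M a \<Longrightarrow> M \<le> N \<Longrightarrow> nvars_below N a"
  by (induction a) auto

lemma vars_below_mono: "vars_below M p \<Longrightarrow> M \<le> N \<Longrightarrow> vars_below N p"
  by (induction p) (auto intro: nvars_below_mono)

lemma ex_nvars_below: "\<exists>M. nvars_below M a"
proof (induction a)
  case (NAdd a b)
  then obtain M N where "nvars_below M a" "nvars_below N b" by blast
  then have "nvars_below (max M N) (NAdd a b)" by (auto intro: nvars_below_mono)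
  then show ?case ..
next
  case (NMul a b)
  then obtain M N where "nvars_below M a" "nvars_below N b" by blast
  then have "nvars_below (max M N) (NMul a b)" by (auto intro: nvars_below_mono)
  then show ?case ..
next
  case (NVar i)
  have "nvars_below (2 * i + 1) (NVar i)" by simp
  then show ?case ..
qed auto

lemma ex_vars_below: "\<exists>M. vars_below M p"
proof (induction p)
  case (Lt a b)
  obtain M N where "nvars_below M a" "nvars_below N b" using ex_nvars_below by blast
  then have "vars_below (max M N) (Lt a b)" by (auto intro: nvars_below_mono)
  then show ?case ..
next
  case (In a j)
  obtain M where "nvars_below M a" using ex_nvars_below by blast
  then have "vars_below (max M (Suc j)) (In a j)" by (auto intro: nvars_below_mono)
  then show ?case ..
next
  case (Nand p q)
  then obtain M N where "vars_below M p" "vars_below N q" by blast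
  then have "vars_below (max M N) (Nand p q)" by (auto intro: vars_below_mono)
  then show ?case ..
qed auto

lemma nval_cong: "nvars_below M a \<Longrightarrow> \<forall>j<M. w j = v j \<Longrightarrow> nval (nenv w) a = nval (nenv v) a"
  by (induction a) auto

text \<open>A predicate symbol receives only the first \<open>M\<close> streams; this is why they
  suffice to determine truth. Under a quantifier, updating both environments at \<open>j\<close>
  preserves their agreement.\<close>

lemma sat_cong: "vars_below M p \<Longrightarrow> \<forall>j<M. w j = v j \<Longrightarrow> sat w p = sat v p"
proof (induction p arbitrary: w v)
  case (Lt a b)
  then show ?case using nval_cong[of M _ w v] by simp
next
  case (In a j)
  then show ?case using nval_cong[of M _ w v] by simp
next
  case (Nand p q)
  have "sat w p = sat v p" "sat w q = sat v q"
    using Nand.prems by (auto intro!: Nand.IH)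
  then show ?case by simp
next
  case (Ex j p)
  have "sat (w(j := x)) p = sat (v(j := x)) p" for x
    using Ex.prems by (intro Ex.IH) auto
  then show ?case by simp
qed


section \<open>The specification\<close>

abbreviation sv :: "nat \<Rightarrow> bterm" where "sv \<equiv> Var StreamSort"
abbreviation bv :: bterm where "bv \<equiv> Var BitSort 0"
abbreviation bit0 :: bterm where "bit0 \<equiv> App Bit0 []"
abbreviation bit1 :: bterm where "bit1 \<equiv> App Bit1 []"
abbreviation cons_t :: "bterm \<Rightarrow> bterm \<Rightarrow> bterm" where "cons_t a t \<equiv> App SCons [a, t]"
abbreviation ones_t :: bterm where "ones_t \<equiv> App (Sym 0) []"
abbreviation zeros_t :: bterm where "zeros_t \<equiv> App (Sym (Suc 0)) []"
abbreviation nand_t :: "bterm \<Rightarrow> bterm \<Rightarrow> bterm" where "nand_t a b \<equiv> App (Sym 2) [a, b]"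
abbreviation fin_t :: "bterm \<Rightarrow> bterm" where "fin_t t \<equiv> App (Sym 3) [t]"
abbreviation sel_t :: "bterm \<Rightarrow> bterm \<Rightarrow> bterm" where "sel_t a t \<equiv> App (Sym 4) [a, t]"
abbreviation add_t :: "bterm \<Rightarrow> bterm \<Rightarrow> bterm" where "add_t s t \<equiv> App (Sym 5) [s, t]"
abbreviation mul_t :: "bterm \<Rightarrow> bterm \<Rightarrow> bterm" where "mul_t s t \<equiv> App (Sym 6) [s, t]"
abbreviation lt_t :: "bterm \<Rightarrow> bterm \<Rightarrow> bterm" where "lt_t s t \<equiv> App (Sym 7) [s, t]"
abbreviation mem_t :: "bterm \<Rightarrow> bterm \<Rightarrow> bterm" where "mem_t s t \<equiv> App (Sym 8) [s, t]"
text \<open>Indices below 9 belong to the fixed operations. From there on odd indices are predicates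
  and even ones Skolem functions, so parity tells the result sort.\<close>

abbreviation pred_t :: "core \<Rightarrow> bterm list \<Rightarrow> bterm" where
  "pred_t p \<equiv> App (Sym (9 + 2 * to_nat p))"
abbreviation skolem_t :: "core \<Rightarrow> bterm list \<Rightarrow> bterm" where
  "skolem_t p \<equiv> App (Sym (10 + 2 * to_nat p))"

definition sym_type :: "nat \<Rightarrow> nat \<Rightarrow> ftype" where
  "sym_type M i =
     (if i < 9
      then [([], StreamSort), ([], StreamSort), ([BitSort, BitSort], BitSort),
        ([StreamSort], BitSort), ([BitSort, StreamSort], StreamSort),
        ([StreamSort, StreamSort], StreamSort), ([StreamSort, StreamSort], StreamSort),
        ([StreamSort, StreamSort], BitSort), ([StreamSort, StreamSort], BitSort)] ! i
      else (replicate M StreamSort, if odd i then BitSort else StreamSort))"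

text \<open>An instance lists finitely many symbols, so the signature is cut off at
  \<open>K\<close>. Symbols below \<open>K\<close> that no equation mentions may be interpreted
  freely.\<close>

definition types :: "nat \<Rightarrow> nat \<Rightarrow> ftype list" where
  "types M K = map (sym_type M) [0..<K]"

text \<open>Recursion along a unary code fixes the arithmetic operations on streams that code
  numbers. The stream of ones is never exhausted by it, hence the separate equation for
  \<open>fin_t ones_t\<close>.\<close>

definition base_eqs :: "equation list" where
  "base_eqs =
    [(ones_t, cons_t bit1 ones_t), (zeros_t, cons_t bit0 zeros_t),
     (nand_t bit0 bv, bit1), (nand_t bit1 bit0, bit1), (nand_t bit1 bit1, bit0),
     (fin_t (cons_t bit0 (sv 0)), bit1), (fin_t (cons_t bit1 (sv 0)), fin_t (sv 0)),
     (fin_t ones_t, bit0),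
     (sel_t bit1 (sv 0), sv 0), (sel_t bit0 (sv 0), zeros_t),
     (add_t (cons_t bit0 (sv 0)) (sv 1), sv 1),
     (add_t (cons_t bit1 (sv 0)) (sv 1), cons_t bit1 (add_t (sv 0) (sv 1))),
     (mul_t (cons_t bit0 (sv 0)) (sv 1), zeros_t),
     (mul_t (cons_t bit1 (sv 0)) (sv 1), add_t (sv 1) (mul_t (sv 0) (sv 1))),
     (lt_t (sv 0) (cons_t bit0 (sv 1)), bit0),
     (lt_t (cons_t bit0 (sv 0)) (cons_t bit1 (sv 1)), bit1),
     (lt_t (cons_t bit1 (sv 0)) (cons_t bit1 (sv 1)), lt_t (sv 0) (sv 1)),
     (mem_t (cons_t bit0 (sv 0)) (cons_t bv (sv 1)), bv),
     (mem_t (cons_t bit1 (sv 0)) (cons_t bv (sv 1)), mem_t (sv 0) (sv 1))]"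

text \<open>
  A stream variable holding no number (the stream of ones) is replaced by 0, in accordance with
  \<^const>\<open>num\<close>.
\<close>

fun nterm_t :: "nterm \<Rightarrow> bterm" where
  "nterm_t (NVar i) = sel_t (fin_t (sv (2 * i))) (sv (2 * i))"
| "nterm_t NZero = zeros_t"
| "nterm_t NOne = cons_t bit1 zeros_t"
| "nterm_t (NAdd a b) = add_t (nterm_t a) (nterm_t b)"
| "nterm_t (NMul a b) = mul_t (nterm_t a) (nterm_t b)"

definition vars :: "nat \<Rightarrow> bterm list" where
  "vars M = map sv [0..<M]"

text \<open>
  In the last equation the variable \<open>M\<close> lies outside \<open>vars M\<close>, so it ranges over all streams while
  the predicate of \<open>Ex j p\<close>, which formally has \<open>j\<close> among its arguments, keeps its value.
\<close>

fun core_eqs :: "nat \<Rightarrow> core \<Rightarrow> equation list" where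
  "core_eqs M (Lt a b) = [(pred_t (Lt a b) (vars M), lt_t (nterm_t a) (nterm_t b))]"
| "core_eqs M (In a j) = [(pred_t (In a j) (vars M), mem_t (nterm_t a) (sv j))]"
| "core_eqs M (Nand p q) =
     [(pred_t (Nand p q) (vars M), nand_t (pred_t p (vars M)) (pred_t q (vars M)))]"
| "core_eqs M (Ex j p) =
     [(pred_t (Ex j p) (vars M), pred_t p ((vars M)[j := skolem_t (Ex j p) (vars M)])),
      (nand_t (pred_t p ((vars M)[j := sv M]))
         (nand_t (pred_t (Ex j p) (vars M)) (pred_t (Ex j p) (vars M))), bit1)]"

fun subs :: "core \<Rightarrow> core list" where
  "subs (Nand p q) = Nand p q # subs p @ subs q"
| "subs (Ex j p) = Ex j p # subs p"
| "subs p = [p]"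

lemma self_in_subs: "p \<in> set (subs p)"
  by (cases p) auto

lemma subs_trans: "q \<in> set (subs p) \<Longrightarrow> set (subs q) \<subseteq> set (subs p)"
  by (induction p) auto

lemma subs_vars_below: "q \<in> set (subs p) \<Longrightarrow> vars_below M p \<Longrightarrow> vars_below M q"
  by (induction p) auto

definition spec :: "nat \<Rightarrow> core \<Rightarrow> equation list" where
  "spec M p = base_eqs @ concat (map (core_eqs M) (subs p))"

definition numeral_t :: "nat \<Rightarrow> bterm" where
  "numeral_t n = (cons_t bit1 ^^ n) zeros_t"

text \<open>The queried terms must have sort \<open>StreamSort\<close>, so the truth bit is put in
  front of the zeros. Stream variable 0 represents number variable 0, the argument of the defined
  set.\<close>

definition query_t :: "nat \<Rightarrow> core \<Rightarrow> nat \<Rightarrow> bterm" where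
  "query_t M p n = cons_t (pred_t p ((vars M)[0 := numeral_t n])) zeros_t"

subsection \<open>Sorts\<close>

lemma sig_of_types: "sig_of (types M K) (Sym i) = (if i < K then Some (sym_type M i) else None)"
  by (simp add: types_def)

lemma sort_App_Sym:
  "i < K \<Longrightarrow> sym_type M i = (ss, s) \<Longrightarrow> list_all2 (has_sort (sig_of (types M K))) ts ss \<Longrightarrow>
   has_sort (sig_of (types M K)) (App (Sym i) ts) s"
  by (rule has_sort.intros(2)) (auto simp: types_def)

lemma sort_bit: "has_sort (sig_of ds) bit0 BitSort" "has_sort (sig_of ds) bit1 BitSort"
  by (rule has_sort.intros(2); simp)+

lemma sort_cons:
  "has_sort (sig_of ds) a BitSort \<Longrightarrow> has_sort (sig_of ds) t StreamSort \<Longrightarrow>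
   has_sort (sig_of ds) (cons_t a t) StreamSort"
  by (rule has_sort.intros(2)) auto

lemma sort_vars: "list_all2 (has_sort \<Sigma>) (vars M) (replicate M StreamSort)"
  by (auto simp: list_all2_conv_all_nth vars_def intro: has_sort.intros)

lemma sort_vars_upd:
  "has_sort \<Sigma> t StreamSort \<Longrightarrow>
   list_all2 (has_sort \<Sigma>) ((vars M)[j := t]) (replicate M StreamSort)"
  by (cases "j < M")
    (auto simp: list_all2_conv_all_nth vars_def nth_list_update intro: has_sort.intros)

context
  fixes M K :: nat
  assumes K: "9 \<le> K"
begin

lemma sort_base:
  fixes \<Sigma> defines "\<Sigma> \<equiv> sig_of (types M K)"
  shows "has_sort \<Sigma> ones_t StreamSort" "has_sort \<Sigma> zeros_t StreamSort"
    "has_sort \<Sigma> a BitSort \<Longrightarrow> has_sort \<Sigma> b BitSort \<Longrightarrow> has_sort \<Sigma> (nand_t a b) BitSort"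
    "has_sort \<Sigma> s StreamSort \<Longrightarrow> has_sort \<Sigma> (fin_t s) BitSort"
    "has_sort \<Sigma> a BitSort \<Longrightarrow> has_sort \<Sigma> s StreamSort \<Longrightarrow> has_sort \<Sigma> (sel_t a s) StreamSort"
    "has_sort \<Sigma> s StreamSort \<Longrightarrow> has_sort \<Sigma> t StreamSort \<Longrightarrow> has_sort \<Sigma> (add_t s t) StreamSort"
    "has_sort \<Sigma> s StreamSort \<Longrightarrow> has_sort \<Sigma> t StreamSort \<Longrightarrow> has_sort \<Sigma> (mul_t s t) StreamSort"
    "has_sort \<Sigma> s StreamSort \<Longrightarrow> has_sort \<Sigma> t StreamSort \<Longrightarrow> has_sort \<Sigma> (lt_t s t) BitSort"
    "has_sort \<Sigma> s StreamSort \<Longrightarrow> has_sort \<Sigma> t StreamSort \<Longrightarrow> has_sort \<Sigma> (mem_t s t) BitSort"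
  using K unfolding \<Sigma>_def by (auto intro!: sort_App_Sym simp: sym_type_def)

lemmas sort_intros = sort_base sort_bit sort_cons has_sort.intros(1)

lemma sort_base_eqs:
  assumes "(l, r) \<in> set base_eqs"
  shows "\<exists>s. has_sort (sig_of (types M K)) l s \<and> has_sort (sig_of (types M K)) r s"
proof -
  have "has_sort (sig_of (types M K)) l BitSort \<and> has_sort (sig_of (types M K)) r BitSort \<or>
      has_sort (sig_of (types M K)) l StreamSort \<and> has_sort (sig_of (types M K)) r StreamSort"
    using assms unfolding base_eqs_def by (auto intro: sort_intros)
  then show ?thesis by blast
qed

lemma sort_nterm: "has_sort (sig_of (types M K)) (nterm_t a) StreamSort"
  by (induction a) (simp_all add: sort_intros)

lemma sort_numeral: "has_sort (sig_of (types M K)) (numeral_t n) StreamSort"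
  by (induction n) (simp_all add: numeral_t_def sort_intros)

lemma sort_pred:
  "9 + 2 * to_nat p < K \<Longrightarrow> list_all2 (has_sort (sig_of (types M K))) ts (replicate M StreamSort) \<Longrightarrow>
   has_sort (sig_of (types M K)) (pred_t p ts) BitSort"
  by (auto intro!: sort_App_Sym simp: sym_type_def)

lemma sort_skolem:
  "10 + 2 * to_nat p < K \<Longrightarrow> list_all2 (has_sort (sig_of (types M K))) ts (replicate M StreamSort) \<Longrightarrow>
   has_sort (sig_of (types M K)) (skolem_t p ts) StreamSort"
  by (auto intro!: sort_App_Sym simp: sym_type_def)

lemma sort_core_eqs:
  assumes "\<forall>q\<in>set (subs p). 10 + 2 * to_nat q < K" "(l, r) \<in> set (core_eqs M p)"
  shows "has_sort (sig_of (types M K)) l BitSort \<and> has_sort (sig_of (types M K)) r BitSort"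
proof (cases p)
  case (Lt a b)
  then show ?thesis using assms by (auto intro!: sort_base sort_pred sort_vars sort_nterm)
next
  case (In a j)
  then show ?thesis
    using assms by (auto intro!: sort_base sort_pred sort_vars sort_nterm has_sort.intros(1))
next
  case (Nand q q')
  then have "10 + 2 * to_nat p < K" "10 + 2 * to_nat q < K" "10 + 2 * to_nat q' < K"
    using assms(1) self_in_subs by auto
  then show ?thesis using assms(2) Nand by (auto intro!: sort_base sort_pred sort_vars)
next
  case (Ex j q)
  then have "10 + 2 * to_nat p < K" "10 + 2 * to_nat q < K"
    using assms(1) self_in_subs by auto
  then show ?thesis
    using assms(2) Ex
    by (auto intro!: sort_base sort_bit sort_pred sort_skolem sort_vars sort_vars_upd
        has_sort.intros(1))
qed

lemma spec_sorted:
  assumes "\<forall>q\<in>set (subs p). 10 + 2 * to_nat q < K"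
  shows "bitstream_spec (sig_of (types M K)) (set (spec M p))"
proof -
  have "\<exists>s. has_sort (sig_of (types M K)) l s \<and> has_sort (sig_of (types M K)) r s"
    if lr: "(l, r) \<in> set (spec M p)" for l r
  proof (cases "(l, r) \<in> set base_eqs")
    case False
    then obtain q where q: "q \<in> set (subs p)" "(l, r) \<in> set (core_eqs M q)"
      using lr by (auto simp: spec_def)
    then have "\<forall>q'\<in>set (subs q). 10 + 2 * to_nat q' < K" using assms subs_trans by blast
    then show ?thesis using sort_core_eqs q(2) by blast
  qed (rule sort_base_eqs)
  then show ?thesis by (auto simp: bitstream_spec_def bitstream_signature_def)
qed

lemma query_sorted:
  assumes "9 + 2 * to_nat p < K"
  shows "has_sort (sig_of (types M K)) (query_t M p n) StreamSort"
  unfolding query_t_def using assms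
  by (intro sort_intros sort_pred sort_vars_upd sort_numeral)

end

section \<open>Full models determine truth\<close>

text \<open>Strips the tags from assignments: validity over the full carrier becomes a statement
  about plain bits and the same environments \<open>w\<close> that \<open>sat\<close> uses.\<close>

definition asg :: "(nat \<Rightarrow> bool) \<Rightarrow> env \<Rightarrow> assignment" where
  "asg b w s j = (case s of BitSort \<Rightarrow> BitVal (b j) | StreamSort \<Rightarrow> StreamVal (w j))"

lemma asg_simps [simp]:
  "asg b w BitSort j = BitVal (b j)" "asg b w StreamSort j = StreamVal (w j)"
  by (simp_all add: asg_def)

lemma sort_respecting_UNIV_iff: "sort_respecting UNIV \<alpha> \<longleftrightarrow> (\<exists>b w. \<alpha> = asg b w)"
proof
  assume "sort_respecting UNIV \<alpha>"
  then have "\<forall>j. \<exists>b. \<alpha> BitSort j = BitVal b" "\<forall>j. \<exists>x. \<alpha> StreamSort j = StreamVal x"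
    unfolding sort_respecting_def by (metis carrier.simps rangeE)+
  then obtain b w where bw: "\<alpha> BitSort j = BitVal (b j)" "\<alpha> StreamSort j = StreamVal (w j)" for j
    by metis
  have "\<alpha> s j = asg b w s j" for s j
    by (cases s) (simp_all add: bw)
  then have "\<alpha> = asg b w" by blast
  then show "\<exists>b w. \<alpha> = asg b w" by blast
next
  assume "\<exists>b w. \<alpha> = asg b w"
  then obtain b w where "\<alpha> = asg b w" by blast
  moreover have "asg b w s j \<in> carrier UNIV s" for s j
    by (cases s) auto
  ultimately show "sort_respecting UNIV \<alpha>" by (simp add: sort_respecting_def)
qed

lemma satisfies_eq_UNIV_iff:
  "satisfies_eq UNIV I (l, r) \<longleftrightarrow>
     (\<forall>b w. eval_term I (asg b w) l = eval_term I (asg b w) r)"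
  by (auto simp: satisfies_eq_def sort_respecting_UNIV_iff)

lemma satisfiesD:
  "satisfies_eq UNIV I (l, r) \<Longrightarrow> eval_term I (asg b w) l = eval_term I (asg b w) r"
  by (simp add: satisfies_eq_UNIV_iff)

text \<open>Only the base equations are assumed, so the evaluation of arithmetic terms is available
  both for arbitrary full models and for checking the standard model.\<close>

locale base_model =
  fixes I :: interp and M K :: nat
  assumes alg: "stream_algebra (sig_of (types M K)) UNIV I"
    and K: "9 \<le> K"
    and base: "\<And>e. e \<in> set base_eqs \<Longrightarrow> satisfies_eq UNIV I e"
begin

lemma bits [simp]: "I Bit0 [] = BitVal False" "I Bit1 [] = BitVal True"
  and scons [simp]: "I SCons [BitVal b, StreamVal x] = StreamVal (case_nat b x)"
  using alg by (auto simp: stream_algebra_def)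

lemma I_Sym:
  "i < K \<Longrightarrow> sym_type M i = (ss, s) \<Longrightarrow> list_all2 (\<lambda>v u. v \<in> carrier UNIV u) vs ss \<Longrightarrow>
   I (Sym i) vs \<in> carrier UNIV s"
  using alg sig_of_types[of M K i] unfolding stream_algebra_def by (metis (no_types, lifting))

text \<open>The base equations use one bit variable and the stream variables 0 and 1, so three
  parameters give all instances of interest.\<close>

lemma base_eval:
  "(l, r) \<in> set base_eqs \<Longrightarrow>
     eval_term I (asg (\<lambda>_. b) (\<lambda>j. if j = 0 then x else y)) l =
     eval_term I (asg (\<lambda>_. b) (\<lambda>j. if j = 0 then x else y)) r"
  using base satisfiesD by blast

lemma ones_fixed: "I (Sym 0) [] = I SCons [BitVal True, I (Sym 0) []]"
  using base_eval[of ones_t "cons_t bit1 ones_t"] by (simp add: base_eqs_def)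

lemma zeros_fixed: "I (Sym (Suc 0)) [] = I SCons [BitVal False, I (Sym (Suc 0)) []]"
  using base_eval[of zeros_t "cons_t bit0 zeros_t"] by (simp add: base_eqs_def)

text \<open>A stream that equals itself with a bit put in front is constant, by induction on the
  position.\<close>

lemma ones: "I (Sym 0) [] = StreamVal (\<lambda>_. True)"
proof -
  obtain z where z: "I (Sym 0) [] = StreamVal z"
    using I_Sym[of 0 "[]" StreamSort "[]"] K by (auto simp: sym_type_def)
  then have fix_z: "z = case_nat True z" using ones_fixed by simp
  have "z i" for i
    by (induction i) (subst fix_z, simp)+
  then show ?thesis using z by (simp add: fun_eq_iff)
qed

lemma zeros: "I (Sym (Suc 0)) [] = StreamVal (\<lambda>_. False)"
proof -
  obtain z where z: "I (Sym (Suc 0)) [] = StreamVal z"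
    using I_Sym[of "Suc 0" "[]" StreamSort "[]"] K by (auto simp: sym_type_def)
  then have fix_z: "z = case_nat False z" using zeros_fixed by simp
  have "\<not> z i" for i
    by (induction i) (subst fix_z, simp)+
  then show ?thesis using z by (simp add: fun_eq_iff)
qed

lemma nand: "I (Sym 2) [BitVal a, BitVal b] = BitVal (\<not> (a \<and> b))"
proof -
  have "I (Sym 2) [BitVal False, BitVal b] = BitVal True"
    using base_eval[of "nand_t bit0 bv" bit1 b] by (simp add: base_eqs_def)
  moreover have "I (Sym 2) [BitVal True, BitVal False] = BitVal True"
    using base_eval[of "nand_t bit1 bit0" bit1] by (simp add: base_eqs_def)
  moreover have "I (Sym 2) [BitVal True, BitVal True] = BitVal False"
    using base_eval[of "nand_t bit1 bit1" bit0] by (simp add: base_eqs_def)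
  ultimately show ?thesis by (cases a; cases b) auto
qed

lemma fin_rec:
  "I (Sym 3) [StreamVal (case_nat False x)] = BitVal True"
  "I (Sym 3) [StreamVal (case_nat True x)] = I (Sym 3) [StreamVal x]"
  "I (Sym 3) [StreamVal (\<lambda>_. True)] = BitVal False"
  using base_eval[of "fin_t (cons_t bit0 (sv 0))" bit1 _ x]
    base_eval[of "fin_t (cons_t bit1 (sv 0))" "fin_t (sv 0)" _ x]
    base_eval[of "fin_t ones_t" bit0]
  by (simp_all add: base_eqs_def ones)

lemma fin_codes: "codes x k \<Longrightarrow> I (Sym 3) [StreamVal x] = BitVal True"
  by (induction k arbitrary: x) (auto elim!: codes_0E codes_SucE simp: fin_rec)

lemma fin: "I (Sym 3) [StreamVal x] = BitVal (\<exists>k. codes x k)"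
proof (cases "\<exists>k. codes x k")
  case False
  \<comment> \<open>If all earlier bits are 1, a 0 at position \<open>i\<close> would make
    \<open>x\<close> a code of \<open>i\<close>.\<close>
  have "x i" for i
    by (induction i rule: less_induct) (use False codes_def in blast)
  then have "x = (\<lambda>_. True)" by auto
  then show ?thesis using fin_rec(3) not_codes_ones by simp
qed (auto dest: fin_codes)

lemma sel: "I (Sym 4) [BitVal b, StreamVal x] = StreamVal (if b then x else (\<lambda>_. False))"
  using base_eval[of "sel_t bit1 (sv 0)" "sv 0" _ x] base_eval[of "sel_t bit0 (sv 0)" zeros_t _ x]
  by (cases b) (simp_all add: base_eqs_def zeros)

lemma add_rec:
  "I (Sym 5) [StreamVal (case_nat False x), StreamVal y] = StreamVal y"
  "I (Sym 5) [StreamVal (case_nat True x), StreamVal y] =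
     I SCons [BitVal True, I (Sym 5) [StreamVal x, StreamVal y]]"
  using base_eval[of "add_t (cons_t bit0 (sv 0)) (sv 1)" "sv 1" _ x y]
    base_eval[of "add_t (cons_t bit1 (sv 0)) (sv 1)" "cons_t bit1 (add_t (sv 0) (sv 1))" _ x y]
  by (simp_all add: base_eqs_def)

lemma add:
  "codes x m \<Longrightarrow> codes y k \<Longrightarrow>
   \<exists>z. I (Sym 5) [StreamVal x, StreamVal y] = StreamVal z \<and> codes z (m + k)"
proof (induction m arbitrary: x)
  case 0
  then show ?case by (auto elim!: codes_0E simp: add_rec)
next
  case (Suc m)
  obtain x' where x': "x = case_nat True x'" "codes x' m" using Suc.prems(1) by (rule codes_SucE)
  then obtain z where "I (Sym 5) [StreamVal x', StreamVal y] = StreamVal z" "codes z (m + k)"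
    using Suc by blast
  then show ?case using x' by (simp add: add_rec codes_True)
qed

lemma mul_rec:
  "I (Sym 6) [StreamVal (case_nat False x), StreamVal y] = StreamVal (\<lambda>_. False)"
  "I (Sym 6) [StreamVal (case_nat True x), StreamVal y] =
     I (Sym 5) [StreamVal y, I (Sym 6) [StreamVal x, StreamVal y]]"
  using base_eval[of "mul_t (cons_t bit0 (sv 0)) (sv 1)" zeros_t _ x y]
    base_eval[of "mul_t (cons_t bit1 (sv 0)) (sv 1)" "add_t (sv 1) (mul_t (sv 0) (sv 1))" _ x y]
  by (simp_all add: base_eqs_def zeros)

lemma mul:
  "codes x m \<Longrightarrow> codes y k \<Longrightarrow>
   \<exists>z. I (Sym 6) [StreamVal x, StreamVal y] = StreamVal z \<and> codes z (m * k)"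
proof (induction m arbitrary: x)
  case 0
  then show ?case by (auto elim!: codes_0E simp: mul_rec) (simp add: codes_def)
next
  case (Suc m)
  obtain x' where x': "x = case_nat True x'" "codes x' m" using Suc.prems(1) by (rule codes_SucE)
  then obtain z where z: "I (Sym 6) [StreamVal x', StreamVal y] = StreamVal z" "codes z (m * k)"
    using Suc by blast
  then show ?case using x' add[OF Suc.prems(2) z(2)] by (simp add: mul_rec)
qed

lemma lt_rec:
  "I (Sym 7) [StreamVal x, StreamVal (case_nat False y)] = BitVal False"
  "I (Sym 7) [StreamVal (case_nat False x), StreamVal (case_nat True y)] = BitVal True"
  "I (Sym 7) [StreamVal (case_nat True x), StreamVal (case_nat True y)] =
     I (Sym 7) [StreamVal x, StreamVal y]"
  using base_eval[of "lt_t (sv 0) (cons_t bit0 (sv 1))" bit0 _ x y]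
    base_eval[of "lt_t (cons_t bit0 (sv 0)) (cons_t bit1 (sv 1))" bit1 _ x y]
    base_eval[of "lt_t (cons_t bit1 (sv 0)) (cons_t bit1 (sv 1))" "lt_t (sv 0) (sv 1)" _ x y]
  by (simp_all add: base_eqs_def)

lemma lt: "codes x m \<Longrightarrow> codes y k \<Longrightarrow> I (Sym 7) [StreamVal x, StreamVal y] = BitVal (m < k)"
proof (induction k arbitrary: x y m)
  case 0
  then show ?case by (auto elim!: codes_0E simp: lt_rec)
next
  case (Suc k)
  then show ?case by (cases m) (auto elim!: codes_0E codes_SucE simp: lt_rec)
qed

lemma mem_rec:
  "I (Sym 8) [StreamVal (case_nat False x), StreamVal (case_nat b y)] = BitVal b"
  "I (Sym 8) [StreamVal (case_nat True x), StreamVal (case_nat b y)] =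
     I (Sym 8) [StreamVal x, StreamVal y]"
  using base_eval[of "mem_t (cons_t bit0 (sv 0)) (cons_t bv (sv 1))" bv b x y]
    base_eval[of "mem_t (cons_t bit1 (sv 0)) (cons_t bv (sv 1))" "mem_t (sv 0) (sv 1)" b x y]
  by (simp_all add: base_eqs_def)

text \<open>Each 1 removed from the code also drops one bit of \<open>y\<close>, so bit
  \<open>m\<close> is at the head when the 0 is reached.\<close>

lemma mem: "codes x m \<Longrightarrow> I (Sym 8) [StreamVal x, StreamVal y] = BitVal (y m)"
proof (induction m arbitrary: x y)
  case 0
  then obtain x' where "x = case_nat False x'" by (rule codes_0E)
  then show ?case using mem_rec(1)[of x' "y 0" "\<lambda>i. y (Suc i)"] by (simp add: stream_shape)
next
  case (Suc m)
  obtain x' where x': "x = case_nat True x'" "codes x' m" using Suc.prems(1) by (rule codes_SucE)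
  then show ?case
    using mem_rec(2)[of x' "y 0" "\<lambda>i. y (Suc i)"] Suc.IH[of x'] by (simp add: stream_shape)
qed

text \<open>Terms with the same value can denote streams with different tails, so the induction
  tracks the coded number and not the stream.\<close>

lemma eval_nterm:
  "\<exists>z. eval_term I (asg b w) (nterm_t a) = StreamVal z \<and> codes z (nval (nenv w) a)"
proof (induction a)
  case (NVar i)
  show ?case
    by (auto simp: fin sel num_codes) (auto simp: num_def codes_def)
next
  case NZero
  show ?case using zeros by (simp add: codes_def)
next
  case NOne
  show ?case using zeros by (simp add: codes_True) (simp add: codes_def)
next
  case (NAdd a1 a2)
  then show ?case using add by fastforce
next
  case (NMul a1 a2)
  then show ?case using mul by fastforce
qed

lemma eval_lt:
  "eval_term I (asg b w) (lt_t (nterm_t a) (nterm_t a')) =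
     BitVal (nval (nenv w) a < nval (nenv w) a')"
  using eval_nterm[of b w a] eval_nterm[of b w a'] lt by auto

lemma eval_mem:
  "eval_term I (asg b w) (mem_t (nterm_t a) (sv j)) = BitVal (w j (nval (nenv w) a))"
  using eval_nterm[of b w a] mem by auto

lemma eval_nand:
  "eval_term I \<alpha> s = BitVal a \<Longrightarrow> eval_term I \<alpha> t = BitVal c \<Longrightarrow>
   eval_term I \<alpha> (nand_t s t) = BitVal (\<not> (a \<and> c))"
  by (simp add: nand)

lemma eval_numeral: "eval_term I (asg b w) (numeral_t n) = StreamVal (\<lambda>i. i < n)"
proof (induction n)
  case 0
  then show ?case using zeros by (simp add: numeral_t_def)
next
  case (Suc n)
  then have "eval_term I (asg b w) (numeral_t (Suc n)) = StreamVal (case_nat True (\<lambda>i. i < n))"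
    by (simp add: numeral_t_def)
  also have "case_nat True (\<lambda>i. i < n) = (\<lambda>i. i < Suc n)"
    by (auto split: nat.splits)
  finally show ?case .
qed

section \<open>Predicate symbols denote truth values\<close>

lemma eval_vars: "map (eval_term I (asg b w)) (vars M) = map (\<lambda>j. StreamVal (w j)) [0..<M]"
  by (simp add: vars_def)

text \<open>Substitution into the argument list corresponds to an update of the environment; for
  \<open>M \<le> j\<close> neither has an effect on the arguments.\<close>

lemma eval_upd:
  assumes "eval_term I (asg b w) t = StreamVal x"
  shows "eval_term I (asg b w) (App f ((vars M)[j := t])) =
    eval_term I (asg b (w(j := x))) (App f (vars M))"
proof -
  have "map (eval_term I (asg b w)) ((vars M)[j := t]) = map (eval_term I (asg b (w(j := x)))) (vars M)"
    using assms by (cases "j < M") (auto simp: list_eq_iff_nth_eq nth_list_update vars_def)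
  then show ?thesis by simp
qed

lemma eval_vars_cong:
  assumes "\<And>j. j < M \<Longrightarrow> w j = v j"
  shows "eval_term I (asg b w) (App f (vars M)) = eval_term I (asg b v) (App f (vars M))"
proof -
  have "map (eval_term I (asg b w)) (vars M) = map (eval_term I (asg b v)) (vars M)"
    using assms by (auto simp: vars_def)
  then show ?thesis by (simp only: eval_term.simps)
qed

text \<open>In an arbitrary model only the sort of a Skolem value is known. This is enough, as the
  equations force it to be a witness whenever one exists.\<close>

lemma eval_skolem:
  assumes "10 + 2 * to_nat p < K"
  shows "\<exists>x. eval_term I (asg b w) (skolem_t p (vars M)) = StreamVal x"
  using I_Sym[of "10 + 2 * to_nat p" "replicate M StreamSort" StreamSort
      "map (\<lambda>j. StreamVal (w j)) [0..<M]"] assms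
  by (auto simp: eval_vars sym_type_def list_all2_conv_all_nth)

text \<open>Each equation reduces a predicate to those of its immediate subformulas. For
  \<open>Ex j p\<close> the first equation makes its value the truth of \<open>p\<close> at the
  Skolem value, so that truth implies a witness; the second lets any witness force truth.\<close>

lemma eval_pred:
  assumes "\<And>q e. q \<in> set (subs p) \<Longrightarrow> e \<in> set (core_eqs M q) \<Longrightarrow> satisfies_eq UNIV I e"
    and "\<forall>q\<in>set (subs p). 10 + 2 * to_nat q < K"
  shows "eval_term I (asg b w) (pred_t p (vars M)) = BitVal (sat w p)"
  using assms
proof (induction p arbitrary: w)
  case (Lt a a')
  have "satisfies_eq UNIV I (pred_t (Lt a a') (vars M), lt_t (nterm_t a) (nterm_t a'))"
    by (rule Lt.prems) auto
  then show ?case by (simp only: satisfiesD eval_lt sat.simps)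
next
  case (In a j)
  have "satisfies_eq UNIV I (pred_t (In a j) (vars M), mem_t (nterm_t a) (sv j))"
    by (rule In.prems) auto
  then show ?case by (simp only: satisfiesD eval_mem sat.simps)
next
  case (Nand p q)
  have "satisfies_eq UNIV I (pred_t (Nand p q) (vars M), nand_t (pred_t p (vars M)) (pred_t q (vars M)))"
    by (rule Nand.prems(1)[of "Nand p q"]) auto
  note eq = satisfiesD[OF this, of b w]
  have "eval_term I (asg b w) (pred_t p (vars M)) = BitVal (sat w p)"
    using Nand.prems by (intro Nand.IH) auto
  moreover have "eval_term I (asg b w) (pred_t q (vars M)) = BitVal (sat w q)"
    using Nand.prems by (intro Nand.IH) auto
  ultimately show ?case by (simp only: eq eval_nand sat.simps)
next
  case (Ex j p)
  let ?P = "\<lambda>w. eval_term I (asg b w) (pred_t (Ex j p) (vars M))"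
  have IH: "eval_term I (asg b w) (pred_t p (vars M)) = BitVal (sat w p)" for w
    using Ex.prems by (intro Ex.IH) auto
  have "satisfies_eq UNIV I
      (pred_t (Ex j p) (vars M), pred_t p ((vars M)[j := skolem_t (Ex j p) (vars M)]))"
    by (rule Ex.prems(1)[of "Ex j p"]) auto
  note eq1 = satisfiesD[OF this, of b w]
  obtain x where x: "eval_term I (asg b w) (skolem_t (Ex j p) (vars M)) = StreamVal x"
    using eval_skolem[of "Ex j p" b w] Ex.prems(2) by auto
  have P: "?P w = BitVal (sat (w(j := x)) p)"
    by (simp only: eq1 eval_upd[OF x] IH)
  have "sat w (Ex j p) \<Longrightarrow> sat (w(j := x)) p"
  proof -
    assume "sat w (Ex j p)"
    then obtain y where y: "sat (w(j := y)) p" by auto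
    \<comment> \<open>The witness is stored in the spare variable \<open>M\<close>, which is not
      among \<open>vars M\<close>.\<close>
    let ?w = "w(M := y)"
    have "satisfies_eq UNIV I (nand_t (pred_t p ((vars M)[j := sv M]))
         (nand_t (pred_t (Ex j p) (vars M)) (pred_t (Ex j p) (vars M))), bit1)"
      by (rule Ex.prems(1)[of "Ex j p"]) auto
    note eq2 = satisfiesD[OF this, of b ?w]
    have "eval_term I (asg b ?w) (pred_t p ((vars M)[j := sv M])) =
        eval_term I (asg b (?w(j := y))) (pred_t p (vars M))"
      by (rule eval_upd) simp
    also have "\<dots> = eval_term I (asg b (w(j := y))) (pred_t p (vars M))"
      by (rule eval_vars_cong) simp
    also have "\<dots> = BitVal True" by (simp only: IH y)
    finally have "eval_term I (asg b ?w) (pred_t p ((vars M)[j := sv M])) = BitVal True" .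
    moreover have "?P ?w = ?P w"
      by (rule eval_vars_cong) simp
    \<comment> \<open>\<open>nand_t s (nand_t t t)\<close> is the implication from \<open>s\<close>
      to \<open>t\<close>; since \<open>s\<close> is true here, it takes the value of
      \<open>t\<close>.\<close>
    ultimately have "BitVal (sat (w(j := x)) p) = eval_term I (asg b ?w) bit1"
      unfolding eq2[symmetric] by (simp only: P eval_nand) simp
    then show "sat (w(j := x)) p" by simp
  qed
  then show ?case using P by auto
qed

lemma eval_query:
  assumes "\<And>e. e \<in> set (spec M p) \<Longrightarrow> satisfies_eq UNIV I e"
    and "\<forall>q\<in>set (subs p). 10 + 2 * to_nat q < K"
  shows "eval_term I (asg b w) (query_t M p n) =
    StreamVal (case_nat (sat (w(0 := (\<lambda>i. i < n))) p) (\<lambda>_. False))"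
proof -
  have "eval_term I (asg b w) (pred_t p ((vars M)[0 := numeral_t n])) =
      BitVal (sat (w(0 := (\<lambda>i. i < n))) p)"
    using eval_pred[of p b "w(0 := (\<lambda>i. i < n))"] assms eval_upd[OF eval_numeral]
    by (auto simp: spec_def)
  then show ?thesis using zeros by (simp add: query_t_def)
qed

end


section \<open>The standard model\<close>

text \<open>Recursion on the output position makes addition total, including the case where
  \<open>x\<close> is the stream of ones.\<close>

fun add_str :: "(nat \<Rightarrow> bool) \<Rightarrow> (nat \<Rightarrow> bool) \<Rightarrow> nat \<Rightarrow> bool" where
  "add_str x y 0 \<longleftrightarrow> x 0 \<or> y 0"
| "add_str x y (Suc i) \<longleftrightarrow> (if x 0 then add_str (\<lambda>j. x (Suc j)) y i else y (Suc i))"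

lemma add_str_rec:
  "add_str (case_nat False x) y = y"
  "add_str (case_nat True x) y = case_nat True (add_str x y)"
proof -
  show "add_str (case_nat False x) y = y"
  proof
    show "add_str (case_nat False x) y i = y i" for i by (cases i) auto
  qed
  show "add_str (case_nat True x) y = case_nat True (add_str x y)"
  proof
    show "add_str (case_nat True x) y i = case_nat True (add_str x y) i" for i by (cases i) auto
  qed
qed

lemma add_str_ones: "add_str y (\<lambda>_. True) = (\<lambda>_. True)"
proof
  show "add_str y (\<lambda>_. True) i = True" for i by (induction i arbitrary: y) auto
qed

text \<open>For \<open>x\<close> the stream of ones the product has to be a fixed point of adding
  \<open>y\<close> on the left; the stream of ones is one, by \<open>add_str_ones\<close>.\<close>

definition mul_str :: "(nat \<Rightarrow> bool) \<Rightarrow> (nat \<Rightarrow> bool) \<Rightarrow> nat \<Rightarrow> bool" where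
  "mul_str x y = (if \<exists>k. codes x k then (add_str y ^^ num x) (\<lambda>_. False) else (\<lambda>_. True))"

lemma mul_str_rec:
  "mul_str (case_nat False x) y = (\<lambda>_. False)"
  "mul_str (case_nat True x) y = add_str y (mul_str x y)"
proof -
  have "num (case_nat False x) = 0" by (rule num_codes) (simp add: codes_False)
  then show "mul_str (case_nat False x) y = (\<lambda>_. False)"
    by (simp add: mul_str_def codes_False)
  have "num (case_nat True x) = Suc (num x)" if "codes x k" for k
    using that by (intro num_codes) (simp add: codes_True codes_num)
  then show "mul_str (case_nat True x) y = add_str y (mul_str x y)"
    by (auto simp: mul_str_def codes_True add_str_ones)
qed

definition fin_str :: "(nat \<Rightarrow> bool) \<Rightarrow> bool" where
  "fin_str x \<longleftrightarrow> (\<exists>k. codes x k)"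

text \<open>Comparing \<open>num\<close> values would violate the equations, which also range over
  the stream of ones. Here that stream acts as infinity: above every number and below
  nothing.\<close>

definition lt_str :: "(nat \<Rightarrow> bool) \<Rightarrow> (nat \<Rightarrow> bool) \<Rightarrow> bool" where
  "lt_str x y \<longleftrightarrow> (\<exists>k. codes x k \<and> (\<forall>i\<le>k. y i))"

definition mem_str :: "(nat \<Rightarrow> bool) \<Rightarrow> (nat \<Rightarrow> bool) \<Rightarrow> bool" where
  "mem_str x y \<longleftrightarrow> (\<exists>k. codes x k \<and> y k)"

lemma fin_str_rec:
  "fin_str (case_nat False x)" "fin_str (case_nat True x) = fin_str x"
  "\<not> fin_str (\<lambda>_. True)"
  by (auto simp: fin_str_def codes_False codes_True not_codes_ones)

lemma lt_str_rec:
  "\<not> lt_str x (case_nat False y)"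
  "lt_str (case_nat False x) (case_nat True y)"
  "lt_str (case_nat True x) (case_nat True y) = lt_str x y"
proof -
  show "\<not> lt_str x (case_nat False y)" by (force simp: lt_str_def)
  show "lt_str (case_nat False x) (case_nat True y)" by (simp add: lt_str_def codes_False)
  have "(\<forall>i\<le>Suc k. case_nat True y i) \<longleftrightarrow> (\<forall>i\<le>k. y i)" for k
    by (simp add: less_Suc_eq_le[symmetric] All_less_Suc2)
  then show "lt_str (case_nat True x) (case_nat True y) = lt_str x y"
    by (auto simp: lt_str_def codes_True)
qed

lemma mem_str_rec:
  "mem_str (case_nat False x) (case_nat b y) = b"
  "mem_str (case_nat True x) (case_nat b y) = mem_str x y"
  by (auto simp: mem_str_def codes_False codes_True)

section \<open>The standard interpretation of the symbols\<close>

fun bit_of :: "val \<Rightarrow> bool" where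
  "bit_of (BitVal b) = b"
| "bit_of (StreamVal x) = False"

fun stream_of :: "val \<Rightarrow> nat \<Rightarrow> bool" where
  "stream_of (BitVal b) = (\<lambda>_. False)"
| "stream_of (StreamVal x) = x"

text \<open>Variables beyond the argument list get a default stream, on which truth does not depend
  for formulas satisfying \<open>vars_below\<close>.\<close>

definition env_of :: "val list \<Rightarrow> env" where
  "env_of vs j = (if j < length vs then stream_of (vs ! j) else (\<lambda>_. False))"

text \<open>In a full algebra any function on streams may interpret a symbol, so a choice function
  will do. Where no witness exists, its value is arbitrary.\<close>

fun skolem :: "core \<Rightarrow> env \<Rightarrow> nat \<Rightarrow> bool" where
  "skolem (Ex j p) w = (SOME x. sat (w(j := x)) p)"
| "skolem _ w = (\<lambda>_. False)"

text \<open>Parity separates predicates from Skolem functions, and halving the offset from 9 or 10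
  recovers the number of the formula for \<open>from_nat\<close>.\<close>

fun std :: interp where
  "std Bit0 vs = BitVal False"
| "std Bit1 vs = BitVal True"
| "std SCons vs = StreamVal (case_nat (bit_of (vs ! 0)) (stream_of (vs ! 1)))"
| "std (Sym i) vs =
     (if i < 9
      then let a = vs ! 0; b = vs ! 1; x = stream_of a; y = stream_of b in
        [StreamVal (\<lambda>_. True), StreamVal (\<lambda>_. False), BitVal (\<not> (bit_of a \<and> bit_of b)),
         BitVal (fin_str x), StreamVal (if bit_of a then y else (\<lambda>_. False)),
         StreamVal (add_str x y), StreamVal (mul_str x y),
         BitVal (lt_str x y), BitVal (mem_str x y)] ! i
      else if odd i then BitVal (sat (env_of vs) (from_nat ((i - 9) div 2)))
      else StreamVal (skolem (from_nat ((i - 10) div 2)) (env_of vs)))"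

lemma std_algebra: "stream_algebra (sig_of (types M K)) UNIV std"
proof -
  have "std f vs \<in> carrier UNIV s" if f: "sig_of (types M K) f = Some (ss, s)" for f ss s vs
  proof (cases f)
    case (Sym i)
    then have st: "sym_type M i = (ss, s)"
      using f by (auto simp: types_def split: if_splits)
    consider "i \<in> {0,1,2,3,4,5,6,7,8}" | "9 \<le> i" by force
    then show ?thesis
    proof cases
      case 1
      then show ?thesis using Sym st by (auto simp: sym_type_def)
    next
      case 2
      then show ?thesis using Sym st by (auto simp: sym_type_def split: if_splits)
    qed
  qed (use f in auto)
  then show ?thesis by (auto simp: stream_algebra_def)
qed

lemma std_base: "e \<in> set base_eqs \<Longrightarrow> satisfies_eq UNIV std e"
proof -
  have const: "case_nat c (\<lambda>_. c) = (\<lambda>_. c)" for c :: bool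
    by (auto split: nat.splits)
  show "satisfies_eq UNIV std e" if "e \<in> set base_eqs"
    using that unfolding base_eqs_def
    by (auto simp: satisfies_eq_UNIV_iff const fin_str_rec add_str_rec mul_str_rec
        lt_str_rec mem_str_rec)
qed

lemma std_base_model: "9 \<le> K \<Longrightarrow> base_model std M K"
  by unfold_locales (auto intro: std_algebra std_base)

lemma env_of_vars: "j < M \<Longrightarrow> env_of (map (\<lambda>j. StreamVal (w j)) [0..<M]) j = w j"
  by (simp add: env_of_def)

lemma std_pred:
  assumes "vars_below M p"
  shows "eval_term std (asg b w) (pred_t p (vars M)) = BitVal (sat w p)"
proof -
  have "sat (env_of (map (\<lambda>j. StreamVal (w j)) [0..<M])) p = sat w p"
    using assms by (rule sat_cong) (simp add: env_of_vars)
  then show ?thesis by (simp add: vars_def comp_def)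
qed

lemma std_core_eqs:
  assumes p: "vars_below M p" and e: "e \<in> set (core_eqs M p)"
  shows "satisfies_eq UNIV std e"
proof -
  \<comment> \<open>\<open>std\<close> is the same for every signature length; the nine fixed
    operations suffice to evaluate arithmetic terms.\<close>
  interpret base_model std M 9 by (rule std_base_model) simp
  show ?thesis
  proof (cases p)
    case (Lt a a')
    then have e': "e = (pred_t p (vars M), lt_t (nterm_t a) (nterm_t a'))" using e by simp
    have "eval_term std (asg b w) (pred_t p (vars M)) =
        eval_term std (asg b w) (lt_t (nterm_t a) (nterm_t a'))" for b w
      by (simp only: std_pred[OF p] eval_lt) (simp only: Lt sat.simps)
    then show ?thesis unfolding e' satisfies_eq_UNIV_iff by blast
  next
    case (In a j)
    then have e': "e = (pred_t p (vars M), mem_t (nterm_t a) (sv j))" using e by simp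
    have "eval_term std (asg b w) (pred_t p (vars M)) =
        eval_term std (asg b w) (mem_t (nterm_t a) (sv j))" for b w
      by (simp only: std_pred[OF p] eval_mem) (simp only: In sat.simps)
    then show ?thesis unfolding e' satisfies_eq_UNIV_iff by blast
  next
    case (Nand q q')
    then have e': "e = (pred_t p (vars M), nand_t (pred_t q (vars M)) (pred_t q' (vars M)))"
      using e by simp
    have "eval_term std (asg b w) (pred_t p (vars M)) =
        eval_term std (asg b w) (nand_t (pred_t q (vars M)) (pred_t q' (vars M)))" for b w
    proof -
      have "vars_below M q" "vars_below M q'" using p Nand by auto
      note qs = this[THEN std_pred]
      show ?thesis
        by (simp only: std_pred[OF p] eval_nand[OF qs]) (simp only: Nand sat.simps)
    qed
    then show ?thesis unfolding e' satisfies_eq_UNIV_iff by blast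
  next
    case (Ex j q)
    have q: "vars_below M q" using p Ex by simp
    let ?u = "\<lambda>w. env_of (map (\<lambda>j. StreamVal (w j)) [0..<M])"
    have u: "sat ((?u w)(j := x)) q = sat (w(j := x)) q" for w x
      using q by (rule sat_cong) (simp add: env_of_vars)
    \<comment> \<open>By \<open>u\<close> the truncated environment yields the same predicate of
      \<open>x\<close> as \<open>w\<close>, so \<open>SOME\<close> picks the same stream.\<close>
    have sk: "eval_term std (asg b w) (skolem_t p (vars M)) =
        StreamVal (SOME x. sat (w(j := x)) q)" for b w
      using u by (simp add: vars_def comp_def Ex)
    consider (unfold) "e = (pred_t p (vars M), pred_t q ((vars M)[j := skolem_t p (vars M)]))"
      | (bound) "e = (nand_t (pred_t q ((vars M)[j := sv M]))
         (nand_t (pred_t p (vars M)) (pred_t p (vars M))), bit1)"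
      using e unfolding Ex by auto
    then show ?thesis
    proof cases
      case unfold
      have "eval_term std (asg b w) (pred_t p (vars M)) =
        eval_term std (asg b w) (pred_t q ((vars M)[j := skolem_t p (vars M)]))" for b w
        unfolding std_pred[OF p] eval_upd[OF sk] std_pred[OF q]
        using someI_ex[of "\<lambda>x. sat (w(j := x)) q"] by (auto simp: Ex)
      then show ?thesis unfolding unfold satisfies_eq_UNIV_iff by blast
    next
      case bound
      have "eval_term std (asg b w) (pred_t q ((vars M)[j := sv M])) =
          BitVal (sat (w(j := w M)) q)" for b w
        using eval_upd[of b w "sv M" "w M"] std_pred[OF q] by simp
      \<comment> \<open>The stream held by the spare variable \<open>M\<close> is itself the
        witness.\<close>
      moreover have "sat (w(j := w M)) q \<Longrightarrow> sat w p" for w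
        by (auto simp: Ex)
      ultimately have "eval_term std (asg b w) (nand_t (pred_t q ((vars M)[j := sv M]))
         (nand_t (pred_t p (vars M)) (pred_t p (vars M)))) = BitVal True" for b w
        by (simp only: std_pred[OF p] eval_nand) blast
      then show ?thesis unfolding bound satisfies_eq_UNIV_iff by simp
    qed
  qed
qed

lemma std_full_model:
  assumes "vars_below M p"
  shows "full_model (sig_of (types M K)) (set (spec M p)) UNIV std"
proof -
  have "satisfies_eq UNIV std e" if "e \<in> set (spec M p)" for e
  proof (cases "e \<in> set base_eqs")
    case False
    then obtain q where "q \<in> set (subs p)" "e \<in> set (core_eqs M q)"
      using \<open>e \<in> set (spec M p)\<close> by (auto simp: spec_def)
    then show ?thesis using std_core_eqs subs_vars_below assms by blast
  qed (rule std_base)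
  then show ?thesis by (auto simp: full_model_def is_model_def std_algebra)
qed

text \<open>All full models give the query the same value in each environment, and the standard
  model guarantees that validity over them is not vacuous.\<close>

lemma query_valid_iff:
  assumes p: "vars_below M p" and symbols: "\<forall>q\<in>set (subs p). 10 + 2 * to_nat q < K"
  shows "equal_in_all_full_models (sig_of (types M K)) (set (spec M p))
      (query_t M p n) (cons_t bit1 zeros_t) \<longleftrightarrow> (\<forall>w. sat (w(0 := (\<lambda>i. i < n))) p)"
    (is "?valid \<longleftrightarrow> _")
proof -
  have K9: "9 \<le> K" using symbols self_in_subs[of p] by fastforce
  have sat_iff: "satisfies_eq UNIV I (query_t M p n, cons_t bit1 zeros_t) \<longleftrightarrow>
      (\<forall>w. sat (w(0 := (\<lambda>i. i < n))) p)"
    if "full_model (sig_of (types M K)) (set (spec M p)) A I" for A I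
  proof -
    have I: "stream_algebra (sig_of (types M K)) UNIV I"
      "\<And>e. e \<in> set (spec M p) \<Longrightarrow> satisfies_eq UNIV I e"
      using that by (auto simp: full_model_def is_model_def)
    interpret base_model I M K
      using I K9 by unfold_locales (auto simp: spec_def)
    have "eval_term I (asg b w) (cons_t bit1 zeros_t) = StreamVal (case_nat True (\<lambda>_. False))" for b w
      using zeros by simp
    moreover have "case_nat c (\<lambda>_. False) = case_nat True (\<lambda>_. False) \<longleftrightarrow> c" for c
      by (metis (full_types) old.nat.simps(4))
    ultimately show ?thesis
      unfolding satisfies_eq_UNIV_iff by (simp add: eval_query[OF I(2) symbols] del: eval_term.simps)
  qed
  show ?thesis
  proof
    assume ?valid
    then show "\<forall>w. sat (w(0 := (\<lambda>i. i < n))) p"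
      using std_full_model[OF p] sat_iff unfolding equal_in_all_full_models_def by blast
  next
    assume "\<forall>w. sat (w(0 := (\<lambda>i. i < n))) p"
    then show ?valid
      unfolding equal_in_all_full_models_def using sat_iff by (metis full_model_def)
  qed
qed


section \<open>Computability of the reduction\<close>

text \<open>The equivalence demands that the program yields \<open>f xs\<close> and nothing else, so
  determinism is carried along with computability.\<close>

definition recursive :: "nat \<Rightarrow> (nat list \<Rightarrow> nat) \<Rightarrow> bool" where
  "recursive k f \<longleftrightarrow> (\<exists>p. \<forall>xs. length xs = k \<longrightarrow> (\<forall>y. computes p xs y \<longleftrightarrow> y = f xs))"

inductive_simps computes_Zero: "computes Zero_r xs y"
inductive_simps computes_Succ: "computes Succ_r xs y"
inductive_simps computes_Proj: "computes (Proj_r i) xs y"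
inductive_simps computes_Comp: "computes (Comp_r f gs) xs y"
inductive_simps computes_Prim_0: "computes (Prim_r f g) (0 # xs) y"
inductive_simps computes_Prim_Suc: "computes (Prim_r f g) (Suc n # xs) y"

lemma recursive_zero: "recursive k (\<lambda>xs. 0)"
  unfolding recursive_def by (rule exI[of _ Zero_r]) (simp add: computes_Zero)

lemma recursive_nth: "i < k \<Longrightarrow> recursive k (\<lambda>xs. xs ! i)"
  unfolding recursive_def by (rule exI[of _ "Proj_r i"]) (auto simp: computes_Proj)

lemma recursive_comp1:
  assumes "recursive 1 f" "recursive k g"
  shows "recursive k (\<lambda>xs. f [g xs])"
proof -
  obtain p q where "\<forall>xs. length xs = 1 \<longrightarrow> (\<forall>y. computes p xs y \<longleftrightarrow> y = f xs)"
    "\<forall>xs. length xs = k \<longrightarrow> (\<forall>y. computes q xs y \<longleftrightarrow> y = g xs)"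
    using assms unfolding recursive_def by blast
  then show ?thesis
    unfolding recursive_def
    by (intro exI[of _ "Comp_r p [q]"]) (auto simp: computes_Comp list_all2_Cons1)
qed

lemma recursive_comp2:
  assumes "recursive 2 f" "recursive k g" "recursive k h"
  shows "recursive k (\<lambda>xs. f [g xs, h xs])"
proof -
  obtain p q r where "\<forall>xs. length xs = 2 \<longrightarrow> (\<forall>y. computes p xs y \<longleftrightarrow> y = f xs)"
    "\<forall>xs. length xs = k \<longrightarrow> (\<forall>y. computes q xs y \<longleftrightarrow> y = g xs)"
    "\<forall>xs. length xs = k \<longrightarrow> (\<forall>y. computes r xs y \<longleftrightarrow> y = h xs)"
    using assms unfolding recursive_def by blast
  then show ?thesis
    unfolding recursive_def
    by (intro exI[of _ "Comp_r p [q, r]"]) (auto simp: computes_Comp list_all2_Cons1)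
qed

lemma recursive_Suc: "recursive k g \<Longrightarrow> recursive k (\<lambda>xs. Suc (g xs))"
proof -
  have "recursive 1 (\<lambda>xs. Suc (xs ! 0))"
    unfolding recursive_def
    by (rule exI[of _ Succ_r]) (auto simp: computes_Succ length_Suc_conv)
  from recursive_comp1[OF this] show "recursive k g \<Longrightarrow> recursive k (\<lambda>xs. Suc (g xs))" by simp
qed

lemma recursive_const: "recursive k (\<lambda>xs. c)"
  by (induction c) (auto intro: recursive_zero recursive_Suc)

lemma recursive_rec:
  assumes "recursive k f" "recursive (Suc (Suc k)) g"
  shows "recursive (Suc k) (\<lambda>xs. rec_nat (f (tl xs)) (\<lambda>n y. g (n # y # tl xs)) (hd xs))"
proof -
  obtain p q where p: "\<forall>xs. length xs = k \<longrightarrow> (\<forall>y. computes p xs y \<longleftrightarrow> y = f xs)"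
    and q: "\<forall>xs. length xs = Suc (Suc k) \<longrightarrow> (\<forall>y. computes q xs y \<longleftrightarrow> y = g xs)"
    using assms unfolding recursive_def by blast
  have "computes (Prim_r p q) (n # xs) y \<longleftrightarrow> y = rec_nat (f xs) (\<lambda>n y. g (n # y # xs)) n"
    if "length xs = k" for n xs y
    using that by (induction n arbitrary: y) (simp_all add: computes_Prim_0 computes_Prim_Suc p q)
  then show ?thesis
    unfolding recursive_def by (intro exI[of _ "Prim_r p q"]) (auto simp: length_Suc_conv)
qed

lemma recursive_add:
  assumes "recursive k g" "recursive k h"
  shows "recursive k (\<lambda>xs. g xs + h xs)"
proof -
  have "recursive (Suc 1) (\<lambda>xs. rec_nat (tl xs ! 0) (\<lambda>n y. Suc ((n # y # tl xs) ! 1)) (hd xs))"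
    by (intro recursive_rec recursive_Suc recursive_nth) auto
  moreover have "rec_nat b (\<lambda>n y. Suc y) a = a + b" for a b :: nat
    by (induction a) auto
  ultimately have "recursive 2 (\<lambda>xs. hd xs + tl xs ! 0)"
    by (simp add: numeral_2_eq_2)
  from recursive_comp2[OF this assms] show ?thesis by simp
qed

text \<open>\<open>prod_encode\<close> is built from triangular numbers and addition, so this makes
  pairing recursive.\<close>

lemma recursive_triangle:
  assumes "recursive k g"
  shows "recursive k (\<lambda>xs. triangle (g xs))"
proof -
  have "recursive (Suc 0) (\<lambda>xs. rec_nat 0 (\<lambda>n y. (n # y # tl xs) ! 1 + Suc ((n # y # tl xs) ! 0)) (hd xs))"
    by (intro recursive_rec recursive_Suc recursive_nth recursive_add recursive_zero) auto
  moreover have "rec_nat 0 (\<lambda>n y. y + Suc n) a = triangle a" for a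
    by (induction a) auto
  ultimately have "recursive 1 (\<lambda>xs. triangle (hd xs))"
    by simp
  from recursive_comp1[OF this assms] show ?thesis by simp
qed

lemma recursive_prod_encode:
  "recursive k g \<Longrightarrow> recursive k h \<Longrightarrow> recursive k (\<lambda>xs. prod_encode (g xs, h xs))"
  by (simp add: prod_encode_def recursive_add recursive_triangle)

lemma recursive_sum_encode_Inr:
  "recursive k g \<Longrightarrow> recursive k (\<lambda>xs. sum_encode (Inr (g xs)))"
  by (simp add: sum_encode_def mult_2 recursive_add recursive_Suc)

lemmas recursive_intros =
  recursive_const recursive_nth recursive_Suc recursive_prod_encode recursive_sum_encode_Inr

section \<open>Computing the code of the query from the input\<close>

lemma recursive_numeral_t:
  assumes "recursive k g"
  shows "recursive k (\<lambda>xs. term_code (numeral_t (g xs)))"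
proof -
  \<comment> \<open>One more \<open>cons_t bit1\<close> at the level of codes: 2 is the code of
    \<open>SCons\<close>, the nested \<open>Suc\<close> terms encode its two-element argument list,
    and \<open>xs ! 1\<close> is the code of the preceding numeral.\<close>
  let ?g = "\<lambda>xs. sum_encode (Inr (prod_encode (2,
    Suc (prod_encode (term_code bit1, Suc (prod_encode (xs ! 1, 0)))))))"
  have "recursive (Suc 0) (\<lambda>xs. rec_nat (term_code zeros_t) (\<lambda>n y. ?g (n # y # tl xs)) (hd xs))"
    by (intro recursive_rec recursive_intros) auto
  moreover have "rec_nat (term_code zeros_t) (\<lambda>n y. ?g (n # y # ys)) n = term_code (numeral_t n)"
    for n ys by (induction n) (simp_all add: numeral_t_def)
  ultimately have "recursive 1 (\<lambda>xs. term_code (numeral_t (hd xs)))"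
    by (simp del: term_code.simps)
  from recursive_comp1[OF this assms] show ?thesis by simp
qed

text \<open>With a successor as length, position 0 exists and receives the numeral; the rest of the
  list is the same for all inputs.\<close>

lemma vars_Suc_upd_0: "(vars (Suc M))[0 := t] = t # map sv [1..<Suc M]"
  by (simp add: vars_def upt_rec[of 0] del: upt_Suc)

lemma recursive_query_t: "recursive 1 (\<lambda>xs. term_code (query_t (Suc M) p (xs ! 0)))"
  unfolding query_t_def vars_Suc_upd_0 term_code.simps list.map list_encode.simps
  by (intro recursive_intros recursive_numeral_t) auto

lemma recursive_partial_recursive:
  assumes "recursive 1 f"
  shows "partial_recursive (\<lambda>x. Some (f [x]))"
proof -
  obtain p where "\<forall>xs. length xs = 1 \<longrightarrow> (\<forall>y. computes p xs y \<longleftrightarrow> y = f xs)"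
    using assms unfolding recursive_def by blast
  then show ?thesis unfolding partial_recursive_def by (intro exI[of _ p]) auto
qed

section \<open>The many-one reduction\<close>

theorem theorem3:
  fixes X :: "nat set" and n :: nat
  assumes "X \<in> Sigma1 n \<or> X \<in> Pi1 n"
  shows "many_one_reducible X full_model_equality_problem"
proof -
  obtain \<phi> where \<phi>: "defines_set \<phi> X"
    using assms by (auto simp: Sigma1_def Pi1_def)
  define p where "p = core_of \<phi>"
  obtain M where "vars_below M p" using ex_vars_below by blast
  then have M: "vars_below (Suc M) p" by (rule vars_below_mono) simp
  \<comment> \<open>\<open>10 + 2 * to_nat q\<close> is the larger of the two indices belonging to
    \<open>q\<close>, so one strict bound places both symbols in the signature.\<close>
  obtain K where "\<forall>q\<in>(\<lambda>q. 10 + 2 * to_nat q) ` set (subs p). q < K"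
    using finite_nat_set_iff_bounded by (metis List.finite_set finite_imageI)
  then have K: "\<forall>q\<in>set (subs p). 10 + 2 * to_nat q < K" by simp
  have Kp: "10 + 2 * to_nat p < K" using K self_in_subs by blast
  let ?t = "cons_t bit1 zeros_t"
  let ?inst = "\<lambda>n. (types (Suc M) K, spec (Suc M) p, query_t (Suc M) p n, ?t)"
  let ?f = "\<lambda>xs. instance_code (?inst (xs ! 0))"
  have "recursive 1 ?f"
    unfolding instance_code.simps by (intro recursive_prod_encode recursive_const recursive_query_t)
  then have rec: "partial_recursive (\<lambda>n. Some (instance_code (?inst n)))"
    using recursive_partial_recursive[of ?f] by (simp del: instance_code.simps)
  have sat_iff: "(\<forall>w. sat (w(0 := (\<lambda>i. i < n))) p) \<longleftrightarrow> n \<in> X" for n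
  proof -
    have "sat (w(0 := (\<lambda>i. i < n))) p \<longleftrightarrow> n \<in> X" for w
    proof -
      \<comment> \<open>Number variable 0 thus holds the input, while \<open>defines_set\<close>
        makes the truth of the formula independent of the rest of \<open>w\<close>.\<close>
      have "nenv (w(0 := (\<lambda>i. i < n))) 0 = n" by (simp add: num_less)
      then show ?thesis
        unfolding p_def sat_core_of using \<phi> unfolding defines_set_def by metis
    qed
    then show ?thesis by blast
  qed
  have sorted: "bitstream_spec (sig_of (types (Suc M) K)) (set (spec (Suc M) p))"
    "has_sort (sig_of (types (Suc M) K)) (query_t (Suc M) p n) StreamSort"
    "has_sort (sig_of (types (Suc M) K)) ?t StreamSort" for n
    using Kp K by (auto intro!: spec_sorted query_sorted sort_cons sort_bit sort_base)
  have "instance_code (?inst n) \<in> full_model_equality_problem \<longleftrightarrow> n \<in> X" for n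
  proof -
    have "instance_code (?inst n) \<in> full_model_equality_problem \<longleftrightarrow>
      equal_in_all_full_models (sig_of (types (Suc M) K)) (set (spec (Suc M) p))
        (query_t (Suc M) p n) ?t"
    proof
      assume "instance_code (?inst n) \<in> full_model_equality_problem"
      then obtain ds es s t where "instance_code (?inst n) = instance_code (ds, es, s, t)"
        "equal_in_all_full_models (sig_of ds) (set es) s t"
        unfolding full_model_equality_problem_def by blast
      \<comment> \<open>Membership provides some instance with this code; injectivity of the coding
        identifies it with the constructed one.\<close>
      then show "equal_in_all_full_models (sig_of (types (Suc M) K)) (set (spec (Suc M) p))
          (query_t (Suc M) p n) ?t"
        using inj_instance_code[THEN injD] by blast
    next
      assume "equal_in_all_full_models (sig_of (types (Suc M) K)) (set (spec (Suc M) p))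
          (query_t (Suc M) p n) ?t"
      then show "instance_code (?inst n) \<in> full_model_equality_problem"
        unfolding full_model_equality_problem_def using sorted by blast
    qed
    then show ?thesis using query_valid_iff[OF M K] sat_iff by simp
  qed
  with rec show ?thesis
    unfolding many_one_reducible_def
    by (intro exI[of _ "\<lambda>n. instance_code (?inst n)"]) (simp del: instance_code.simps)
qed

end
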